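(* Assume $\Bbbk$ is an algebraically closed field of characteristic $0$, and let $\mathbb{G}_a=(\Bbbk,+)$ be its additive group. Then $\sigma(\mathbb{G}_a)=2$.
   Context: For a linear algebraic group $G$ over $\Bbbk$, a $G$-module is a finite-dimensional rational representation $V$ of $G$ over $\Bbbk$. $\Bbbk[V]\cong S(V^* )$ is the ring of polynomial functions on $V$, with $G$-action $(g\cdot f)(v)=f(g^{-1}v)$ and invariant ring $\Bbbk[V]^G$, graded by degree. $\Bbbk[V]^G_{\le d}$ is the set of invariants of degree at most $d$. For $S\subseteq \Bbbk[V]$, $S_+$ is the set of elements of $S$ with constant term zero. The nullcone $\mathcal{N}_{G,V}\subseteq V$ is the common zero set of $\Bbbk[V]^G_+$. A subset $S\subseteq\Bbbk[V]^G$ is a $\sigma$-set if for every $v\in V\setminus\mathcal{N}_{G,V}$ there is $f\in S_+$ with $f(v)\neq 0$. Define $\sigma(G,V)=\min\{d\ge 0 : \Bbbk[V]^G_{\le d}\text{ is a }\sigma\text{-set}\}$ and $\sigma(G)=\sup\{\sigma(G,V): V\text{ a }G\text{-module}\}$ (equal to $\infty$ if unbounded). *)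

theory Defs
  imports
    "HOL-Library.Extended_Nat"
    "HOL-Library.FuncSet"
    "HOL-Computational_Algebra.Polynomial"
    "Jordan_Normal_Form.Matrix"
begin

text \<open>A linear algebraic group over an algebraically closed field is given by its group of points
  together with its coordinate ring, the ring of regular functions on these points.\<close>

record ('g, 'k) alg_group = "'g monoid" +
  regular_funs :: "('g \<Rightarrow> 'k) set"

definition additive_alg_group :: "('k, 'k :: field) alg_group" (\<open>\<G>\<^sub>a\<close>) where
  "\<G>\<^sub>a = \<lparr>carrier = UNIV, mult = (+), one = 0, regular_funs = range poly\<rparr>"

lemma group_additive_alg_group: "group (\<G>\<^sub>a :: ('k, 'k :: field) alg_group)"
proof (rule groupI)
  fix x :: 'k
  show "\<exists>y\<in>carrier \<G>\<^sub>a. y \<otimes>\<^bsub>\<G>\<^sub>a\<^esub> x = \<one>\<^bsub>\<G>\<^sub>a\<^esub>"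
    by (rule bexI[of _ "- x"]) (simp_all add: additive_alg_group_def)
qed (simp_all add: additive_alg_group_def add.assoc)

lemma inv_additive_alg_group: "inv\<^bsub>\<G>\<^sub>a\<^esub> (x :: 'k :: field) = - x"
  by (rule group.inv_equality[OF group_additive_alg_group])
    (simp_all add: additive_alg_group_def)

text \<open>Finite-dimensional modules are taken on the coordinate spaces \<open>k\<^sup>n\<close>, i.e. after a choice of
  basis; every finite-dimensional module is isomorphic to one of these.  A representation is
  rational if its matrix entries are regular functions on the group.\<close>

definition rational_rep ::
  "('g, 'k :: field) alg_group \<Rightarrow> nat \<Rightarrow> ('g \<Rightarrow> 'k mat) \<Rightarrow> bool" where
  "rational_rep G n \<rho> \<longleftrightarrow>
     (\<forall>g\<in>carrier G. \<rho> g \<in> carrier_mat n n) \<and>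
     \<rho> \<one>\<^bsub>G\<^esub> = 1\<^sub>m n \<and>
     (\<forall>g\<in>carrier G. \<forall>h\<in>carrier G. \<rho> (g \<otimes>\<^bsub>G\<^esub> h) = \<rho> g * \<rho> h) \<and>
     (\<forall>i<n. \<forall>j<n. \<exists>\<phi>\<in>regular_funs G. \<forall>g\<in>carrier G. \<rho> g $$ (i, j) = \<phi> g)"

definition exponents :: "nat \<Rightarrow> nat \<Rightarrow> (nat \<Rightarrow> nat) set" where
  "exponents n d = {m. (\<forall>i\<ge>n. m i = 0) \<and> (\<Sum>i<n. m i) \<le> d}"

text \<open>Polynomial functions are functions restricted to \<open>carrier_vec n\<close>, so that equality of functions
  is equality on \<open>k\<^sup>n\<close>.  The degree bound is meaningful because polynomials and polynomial functions
  coincide over an infinite field.\<close>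

definition poly_funs_le :: "nat \<Rightarrow> nat \<Rightarrow> ('k :: field vec \<Rightarrow> 'k) set" where
  "poly_funs_le n d =
     {f. \<exists>c. f = (\<lambda>v\<in>carrier_vec n. \<Sum>m\<in>exponents n d. c m * (\<Prod>i<n. v $ i ^ m i))}"

definition poly_funs :: "nat \<Rightarrow> ('k :: field vec \<Rightarrow> 'k) set" where
  "poly_funs n = (\<Union>d. poly_funs_le n d)"

definition act ::
  "('g, 'k :: field) alg_group \<Rightarrow> nat \<Rightarrow> ('g \<Rightarrow> 'k mat) \<Rightarrow> 'g \<Rightarrow> ('k vec \<Rightarrow> 'k) \<Rightarrow> 'k vec \<Rightarrow> 'k" where
  "act G n \<rho> g f = (\<lambda>v\<in>carrier_vec n. f (\<rho> (inv\<^bsub>G\<^esub> g) *\<^sub>v v))"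

definition invariants ::
  "('g, 'k :: field) alg_group \<Rightarrow> nat \<Rightarrow> ('g \<Rightarrow> 'k mat) \<Rightarrow> ('k vec \<Rightarrow> 'k) set" where
  "invariants G n \<rho> = {f \<in> poly_funs n. \<forall>g\<in>carrier G. act G n \<rho> g f = f}"

definition invariants_le ::
  "('g, 'k :: field) alg_group \<Rightarrow> nat \<Rightarrow> ('g \<Rightarrow> 'k mat) \<Rightarrow> nat \<Rightarrow> ('k vec \<Rightarrow> 'k) set" where
  "invariants_le G n \<rho> d = invariants G n \<rho> \<inter> poly_funs_le n d"

text \<open>The constant term of a polynomial function is its value at the origin.\<close>

definition plus_part :: "nat \<Rightarrow> ('k :: field vec \<Rightarrow> 'k) set \<Rightarrow> ('k vec \<Rightarrow> 'k) set" where
  "plus_part n S = {f \<in> S. f (0\<^sub>v n) = 0}"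

definition nullcone ::
  "('g, 'k :: field) alg_group \<Rightarrow> nat \<Rightarrow> ('g \<Rightarrow> 'k mat) \<Rightarrow> 'k vec set" where
  "nullcone G n \<rho> = {v \<in> carrier_vec n. \<forall>f \<in> plus_part n (invariants G n \<rho>). f v = 0}"

definition sigma_set ::
  "('g, 'k :: field) alg_group \<Rightarrow> nat \<Rightarrow> ('g \<Rightarrow> 'k mat) \<Rightarrow> ('k vec \<Rightarrow> 'k) set \<Rightarrow> bool" where
  "sigma_set G n \<rho> S \<longleftrightarrow>
     S \<subseteq> invariants G n \<rho> \<and>
     (\<forall>v \<in> carrier_vec n - nullcone G n \<rho>. \<exists>f \<in> plus_part n S. f v \<noteq> 0)"

text \<open>An infimum in \<^typ>\<open>enat\<close> is a minimum, except that it is \<open>\<infinity>\<close> on the empty set.\<close>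

definition sigma_rep :: "('g, 'k :: field) alg_group \<Rightarrow> nat \<Rightarrow> ('g \<Rightarrow> 'k mat) \<Rightarrow> enat" where
  "sigma_rep G n \<rho> = Inf {enat d | d. sigma_set G n \<rho> (invariants_le G n \<rho> d)}"

definition sigma :: "('g, 'k :: field) alg_group \<Rightarrow> enat" where
  "sigma G = Sup {sigma_rep G n \<rho> | n \<rho>. rational_rep G n \<rho>}"

end

theory Submission
  imports Defs "HOL-Library.Function_Algebras"
begin

text \<open>In characteristic \<open>0\<close> a rational representation of the additive group is \<open>t \<mapsto> exp (t T)\<close> with
  \<open>T\<close> nilpotent.  If a functional \<open>l\<close> satisfies \<open>l \<circ> T ^^ (2 * r + 1) = 0\<close>, then the alternating sum
  of the \<open>l ((T ^^ i) v) * l ((T ^^ (2 * r - i)) v)\<close> is an invariant.  When all these quadratic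
  invariants vanish at \<open>v\<close>, induction on \<open>r\<close> gives \<open>l ((T ^^ r) v) = 0\<close>, that is, by duality,
  \<open>(T ^^ r) v\<close> lies in the range of \<open>T ^^ (2 * r + 1)\<close> for all \<open>r\<close>.  Such a \<open>v\<close> is a sum of vectors
  \<open>(T ^^ a) z\<close> with \<open>(T ^^ (2 * a)) z = 0\<close>.  For these there are polynomial curves \<open>x\<close> and \<open>y\<close> with
  \<open>x 0 = v\<close>, \<open>y 0 = 0\<close> and \<open>x t = exp (T / t) (y t)\<close> for \<open>t \<noteq> 0\<close>, so an invariant \<open>f\<close> agrees on
  \<open>x\<close> and \<open>y\<close> away from \<open>t = 0\<close>, hence also at \<open>t = 0\<close>, and \<open>f v = f 0\<close>.  The bound \<open>2\<close> is attained by the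
  binary quadratic forms, whose discriminant is not seen by the linear invariants.\<close>

section \<open>Finite differences of binomial coefficients and polynomial identities\<close>

text \<open>The left side is the \<open>n\<close>-th forward difference of \<open>x choose q\<close>
  in \<open>x\<close>. By Pascal's rule each difference lowers the bottom index by one, and the
  induction writes the difference of order \<open>n + 1\<close> as a difference of two of order
  \<open>n\<close>.\<close>

lemma alternating_binomial_convolution:
  "(\<Sum>m\<le>n. (-1) ^ (n - m) * of_nat (n choose m) * of_nat ((x + m) choose q)) =
     (if q < n then 0 else of_nat (x choose (q - n)) :: 'a :: comm_ring_1)"
proof (induction n arbitrary: x)
  case 0
  then show ?case by simp
next
  case (Suc n)
  define S where "S x = (\<Sum>m\<le>n. (-1) ^ (n - m) * of_nat (n choose m) * (of_nat ((x + m) choose q) :: 'a))" for x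
  have "(\<Sum>m\<le>Suc n. (-1) ^ (Suc n - m) * of_nat (Suc n choose m) * (of_nat ((x + m) choose q) :: 'a))
      = (-1) ^ Suc n * of_nat (x choose q) +
        (\<Sum>m\<le>n. (-1) ^ (n - m) * of_nat (Suc n choose Suc m) * of_nat ((x + Suc m) choose q))"
    by (simp add: sum.atMost_Suc_shift del: sum.atMost_Suc)
  also have "(\<Sum>m\<le>n. (-1) ^ (n - m) * of_nat (Suc n choose Suc m) * (of_nat ((x + Suc m) choose q) :: 'a))
      = S (Suc x) + (\<Sum>m\<le>n. (-1) ^ (n - m) * of_nat (n choose Suc m) * of_nat ((x + Suc m) choose q))"
    by (simp add: S_def algebra_simps sum.distrib)
  also have "(-1) ^ Suc n * of_nat (x choose q) +
      (S (Suc x) + (\<Sum>m\<le>n. (-1) ^ (n - m) * of_nat (n choose Suc m) * (of_nat ((x + Suc m) choose q) :: 'a)))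
      = S (Suc x) + (\<Sum>m\<le>Suc n. (-1) ^ (Suc n - m) * of_nat (n choose m) * of_nat ((x + m) choose q))"
    by (simp add: sum.atMost_Suc_shift[of _ n] algebra_simps binomial_eq_0 del: sum.atMost_Suc)
  also have "(\<Sum>m\<le>Suc n. (-1) ^ (Suc n - m) * of_nat (n choose m) * (of_nat ((x + m) choose q) :: 'a))
      = - S x"
    by (simp add: S_def Suc_diff_le binomial_eq_0 flip: sum_negf)
  finally have eq: "(\<Sum>m\<le>Suc n. (-1) ^ (Suc n - m) * of_nat (Suc n choose m) * (of_nat ((x + m) choose q) :: 'a))
      = S (Suc x) - S x" by simp
  show ?case
  proof (cases "q \<le> n")
    case True
    then show ?thesis unfolding eq using Suc.IH[of x] Suc.IH[of "Suc x"] by (auto simp: S_def)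
  next
    case False
    then obtain k where "q = Suc n + k" using less_iff_Suc_add by (metis add_Suc add_Suc_right not_le)
    then show ?thesis unfolding eq using Suc.IH[of x] Suc.IH[of "Suc x"] by (simp add: S_def)
  qed
qed

lemma poly_eq_at_0_of_eq_elsewhere:
  fixes p q :: "'a :: field_char_0 poly"
  assumes "\<And>t. t \<noteq> 0 \<Longrightarrow> poly p t = poly q t"
  shows "poly p 0 = poly q 0"
proof -
  \<comment> \<open>The factor \<open>[:0, 1:]\<close> forces agreement at \<open>0\<close>; it can
    be cancelled once equality of functions has become equality of polynomials.\<close>
  have "poly ([:0, 1:] * p) t = poly ([:0, 1:] * q) t" for t
    using assms[of t] by (cases "t = 0") auto
  then have "[:0, 1:] * p = [:0, 1:] * q"
    by (simp only: poly_eq_poly_eq_iff[symmetric] fun_eq_iff) blast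
  then show ?thesis by simp
qed

section \<open>Nilpotent operators on coordinate functions\<close>

text \<open>Vectors become total functions on \<open>nat\<close>, so that operators can be iterated
  with \<open>^^\<close> and form a vector space on a whole type. Positive powers land in functions
  supported below \<open>n\<close>; the power \<open>0\<close> is the identity and does not
  truncate.\<close>

definition mat_op :: "nat \<Rightarrow> (nat \<Rightarrow> nat \<Rightarrow> 'k) \<Rightarrow> (nat \<Rightarrow> 'k :: field_char_0) \<Rightarrow> nat \<Rightarrow> 'k" where
  "mat_op n N v = (\<lambda>i. if i < n then \<Sum>j<n. N i j * v j else 0)"

text \<open>The exponential of \<open>t T\<close> for an operator with \<open>T ^^ K = 0\<close>.\<close>

definition exp_op ::
  "((nat \<Rightarrow> 'k) \<Rightarrow> nat \<Rightarrow> 'k :: field_char_0) \<Rightarrow> nat \<Rightarrow> 'k \<Rightarrow> (nat \<Rightarrow> 'k) \<Rightarrow> nat \<Rightarrow> 'k" where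
  "exp_op T K t v = (\<lambda>i. \<Sum>k<K. t ^ k / fact k * (T ^^ k) v i)"

lemma mat_op_sum:
  "mat_op n N (\<lambda>i. \<Sum>k\<in>A. c k * u k i) = (\<lambda>i. \<Sum>k\<in>A. c k * mat_op n N (u k) i)"
proof
  fix i
  have "(\<Sum>j<n. N i j * (\<Sum>k\<in>A. c k * u k j)) = (\<Sum>j<n. \<Sum>k\<in>A. c k * (N i j * u k j))"
    by (simp add: sum_distrib_left mult_ac)
  also have "\<dots> = (\<Sum>k\<in>A. \<Sum>j<n. c k * (N i j * u k j))"
    by (rule sum.swap)
  finally show "mat_op n N (\<lambda>i. \<Sum>k\<in>A. c k * u k i) i = (\<Sum>k\<in>A. c k * mat_op n N (u k) i)"
    by (simp add: mat_op_def sum_distrib_left)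
qed

lemma mat_op_add: "mat_op n N (\<lambda>i. u i + v i) = (\<lambda>i. mat_op n N u i + mat_op n N v i)"
  by (auto simp: mat_op_def fun_eq_iff sum.distrib algebra_simps)

lemma mat_op_scale: "mat_op n N (\<lambda>i. c * u i) = (\<lambda>i. c * mat_op n N u i)"
  using mat_op_sum[of n N "\<lambda>_. c" "\<lambda>_. u" "{0::nat}"] by simp

lemma mat_op_pow_sum:
  "(mat_op n N ^^ m) (\<lambda>i. \<Sum>k\<in>A. c k * u k i) = (\<lambda>i. \<Sum>k\<in>A. c k * (mat_op n N ^^ m) (u k) i)"
  by (induction m) (simp_all add: mat_op_sum)

lemma mat_op_pow_add:
  "(mat_op n N ^^ m) (\<lambda>i. u i + v i) = (\<lambda>i. (mat_op n N ^^ m) u i + (mat_op n N ^^ m) v i)"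
  by (induction m) (simp_all add: mat_op_add)

lemma mat_op_pow_scale:
  "(mat_op n N ^^ m) (\<lambda>i. c * u i) = (\<lambda>i. c * (mat_op n N ^^ m) u i)"
  by (induction m) (simp_all add: mat_op_scale)

lemma mat_op_zero: "mat_op n N (\<lambda>_. 0) = (\<lambda>_. 0)"
  by (auto simp: mat_op_def fun_eq_iff)

lemma mat_op_pow_zero: "(mat_op n N ^^ m) (\<lambda>_. 0) = (\<lambda>_. 0)"
  by (induction m) (simp_all add: mat_op_zero)

lemma mat_op_pow_zero_mono:
  assumes "(mat_op n N ^^ m) v = (\<lambda>_. 0)" "m \<le> l"
  shows "(mat_op n N ^^ l) v = (\<lambda>_. 0)"
proof -
  have "(mat_op n N ^^ l) v = (mat_op n N ^^ (l - m)) ((mat_op n N ^^ m) v)"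
    using assms(2) by (simp flip: funpow_add[unfolded o_def, THEN fun_cong])
  then show ?thesis using assms by (simp add: mat_op_pow_zero)
qed

lemma mat_op_pow_cong:
  assumes "\<And>j. j < n \<Longrightarrow> u j = v j" "i < n"
  shows "(mat_op n N ^^ m) u i = (mat_op n N ^^ m) v i"
proof (cases m)
  case (Suc l)
  have "mat_op n N u = mat_op n N v"
    using assms(1) by (auto simp: mat_op_def)
  then show ?thesis unfolding Suc funpow_Suc_right by simp
qed (simp add: assms)

lemma exp_op_add:
  "exp_op (mat_op n N) K t (\<lambda>i. u i + v i) =
    (\<lambda>i. exp_op (mat_op n N) K t u i + exp_op (mat_op n N) K t v i)"
  by (auto simp: exp_op_def fun_eq_iff mat_op_pow_add sum.distrib algebra_simps)

lemma exp_op_eq: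
  assumes "\<And>v. (mat_op n N ^^ K) v = (\<lambda>_. 0)" "K \<le> L"
  shows "exp_op (mat_op n N) K t v = exp_op (mat_op n N) L t v"
proof
  fix i
  show "exp_op (mat_op n N) K t v i = exp_op (mat_op n N) L t v i"
    unfolding exp_op_def
  proof (rule sum.mono_neutral_left)
    show "\<forall>k\<in>{..<L} - {..<K}. t ^ k / fact k * (mat_op n N ^^ k) v i = 0"
      using mat_op_pow_zero_mono[OF assms(1)] by auto
  qed (use assms in auto)
qed

text \<open>Finite-dimensional duality: a basis of the range stays independent after adding
  \<open>w\<close>, so some functional is \<open>1\<close> at \<open>w\<close> and \<open>0\<close>
  on the range. Its values on the unit vectors are the coefficients \<open>c\<close>.\<close>

lemma linear_functional_separating:
  fixes T :: "(nat \<Rightarrow> 'k :: field_char_0) \<Rightarrow> nat \<Rightarrow> 'k"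
  assumes add: "\<And>u v. T (\<lambda>i. u i + v i) = (\<lambda>i. T u i + T v i)"
    and scale: "\<And>c u. T (\<lambda>i. c * u i) = (\<lambda>i. c * T u i)"
    and w: "w \<notin> range T"
    and supp: "\<And>i. i \<ge> n \<Longrightarrow> w i = 0" "\<And>u i. i \<ge> n \<Longrightarrow> T u i = 0"
  obtains c where "\<And>u. (\<Sum>j<n. c j * T u j) = 0" "(\<Sum>j<n. c j * w j) \<noteq> 0"
proof -
  let ?s = "\<lambda>(c::'k) (f :: nat \<Rightarrow> 'k) i. c * f i"
  interpret V: vector_space ?s
    by unfold_locales (auto simp: fun_eq_iff algebra_simps)
  interpret VP: vector_space_pair ?s "(*) :: 'k \<Rightarrow> 'k \<Rightarrow> 'k"
    by unfold_locales (auto simp: algebra_simps)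
  have sub: "V.subspace (range T)"
    unfolding V.subspace_def
  proof (intro conjI ballI allI)
    have "T 0 = 0" using scale[of 0 "\<lambda>_. 0"] by (auto simp: fun_eq_iff zero_fun_def)
    then show "0 \<in> range T" by (metis rangeI)
  qed (auto simp: plus_fun_def simp flip: add scale)
  obtain B where B: "B \<subseteq> range T" "V.independent B" "range T \<subseteq> V.span B"
    using V.maximal_independent_subset by blast
  have "V.span B = range T"
    using B sub by (simp add: V.span_minimal subset_antisym)
  then have ind: "V.independent (insert w B)" "w \<notin> B"
    using B w V.independent_insert V.span_base by (metis (no_types) , metis)
  obtain g where g: "Vector_Spaces.linear ?s (*) g" "\<And>x. x \<in> insert w B \<Longrightarrow> g x = (if x = w then 1 else 0)"
    using VP.linear_independent_extend[OF ind(1), of "\<lambda>x. if x = w then 1 else 0"] by blast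
  have "g x = 0" if "x \<in> B" for x
    using g(2)[of x] that ind(2) by auto
  then have gT: "g (T u) = 0" for u
    using VP.linear_eq_0_on_span[OF g(1), of B "T u"] B(3) by auto
  define e where "e j = (\<lambda>i. if i = j then 1 else 0 :: 'k)" for j :: nat
  have eval: "g x = (\<Sum>j<n. g (e j) * x j)" if "\<And>i. i \<ge> n \<Longrightarrow> x i = 0" for x
  proof -
    have "x = (\<Sum>j<n. ?s (x j) (e j))"
    proof
      fix i
      have "(\<Sum>j<n. ?s (x j) (e j)) i = (\<Sum>j<n. x j * e j i)"
        by (induction n) auto
      also have "\<dots> = (\<Sum>j<n. if j = i then x j else 0)"
        by (intro sum.cong) (auto simp: e_def)
      also have "\<dots> = x i"
        using that by (auto simp: not_less)
      finally show "x i = (\<Sum>j<n. ?s (x j) (e j)) i" by simp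
    qed
    then have "g x = g (\<Sum>j<n. ?s (x j) (e j))" by (rule arg_cong)
    also have "\<dots> = (\<Sum>j<n. x j * g (e j))"
      by (simp only: VP.linear_sum[OF g(1)] VP.linear_scale[OF g(1)])
    finally show ?thesis by (simp add: mult.commute)
  qed
  show ?thesis
  proof (rule that[of "\<lambda>j. g (e j)"])
    show "(\<Sum>j<n. g (e j) * T u j) = 0" for u using eval[of "T u"] gT supp by simp
    show "(\<Sum>j<n. g (e j) * w j) \<noteq> 0" using eval[of w] g(2)[of w] supp by simp
  qed
qed

section \<open>Rational representations of the additive group are exponentials\<close>

text \<open>With \<open>N\<close> the derivative of \<open>\<rho>\<close> at \<open>0\<close>, the
  group law turns each orbit into a solution of a linear differential equation. Comparing
  coefficients of \<open>t ^ k\<close>, with division by \<open>k + 1\<close> in characteristic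
  \<open>0\<close>, yields the exponential series; since orbits are polynomial in \<open>t\<close>,
  the series stops and \<open>N\<close> is nilpotent.\<close>

lemma rational_rep_additive_exp:
  fixes \<rho> :: "'k :: field_char_0 \<Rightarrow> 'k mat"
  assumes "rational_rep \<G>\<^sub>a n \<rho>"
  obtains N K where "\<And>v. (mat_op n N ^^ K) v = (\<lambda>_. 0)"
    "\<And>t v i. v \<in> carrier_vec n \<Longrightarrow> i < n \<Longrightarrow> (\<rho> t *\<^sub>v v) $ i = exp_op (mat_op n N) K t (($) v) i"
proof -
  have carr: "\<rho> t \<in> carrier_mat n n" for t
    using assms by (simp add: rational_rep_def additive_alg_group_def)
  have \<rho>0: "\<rho> 0 = 1\<^sub>m n" and \<rho>add: "\<rho> (s + t) = \<rho> s * \<rho> t" for s t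
    using assms by (simp_all add: rational_rep_def additive_alg_group_def)
  have "\<forall>i<n. \<forall>j<n. \<exists>p. \<forall>t. \<rho> t $$ (i, j) = poly p t"
    using assms by (auto simp: rational_rep_def additive_alg_group_def)
  then obtain p where p: "\<And>i j t. i < n \<Longrightarrow> j < n \<Longrightarrow> \<rho> t $$ (i, j) = poly (p i j) t"
    by metis
  \<comment> \<open>Outside the first \<open>n\<close> coordinates the orbit is constant, so
    \<open>R 0\<close> is the identity on all functions, matching
    \<open>mat_op n N ^^ 0\<close>.\<close>
  define P where "P v i = (if i < n then \<Sum>j<n. Polynomial.smult (v j) (p i j) else [:v i:])" for v i
  define R where "R t v = (\<lambda>i. poly (P v i) t)" for t v
  have R: "R t v i = (\<Sum>j<n. \<rho> t $$ (i, j) * v j)" if "i < n" for t v i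
    using that by (simp add: R_def P_def poly_sum p mult.commute)
  have R': "R t v i = v i" if "\<not> i < n" for t v i
    using that by (simp add: R_def P_def)
  define N where "N i j = coeff (p i j) 1" for i j
  have T: "mat_op n N v i = coeff (P v i) 1" for v i
    by (simp add: mat_op_def N_def P_def coeff_sum mult.commute)
  have R0: "R 0 v i = v i" for v i
  proof (cases "i < n")
    case True
    then have "R 0 v i = (\<Sum>j<n. if i = j then v j else 0)"
      unfolding R[OF True] \<rho>0 by (intro sum.cong) auto
    then show ?thesis using True by simp
  qed (simp add: R')
  have Radd: "R (s + t) v i = R s (R t v) i" for s t v i
  proof (cases "i < n")
    case True
    have "R s (R t v) i = (\<Sum>j<n. \<Sum>l<n. \<rho> s $$ (i, j) * \<rho> t $$ (j, l) * v l)"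
      using True by (simp add: R sum_distrib_left mult.assoc)
    also have "\<dots> = (\<Sum>l<n. (\<Sum>j<n. \<rho> s $$ (i, j) * \<rho> t $$ (j, l)) * v l)"
      by (subst sum.swap) (simp add: sum_distrib_right)
    also have "\<dots> = (\<Sum>l<n. \<rho> (s + t) $$ (i, l) * v l)"
      unfolding \<rho>add using True carr[of s] carr[of t]
      by (intro sum.cong) (auto simp: scalar_prod_def atLeast0LessThan)
    finally show ?thesis using True by (simp add: R)
  qed (simp add: R')
  \<comment> \<open>The sum bounds every entry degree at once; \<open>Suc\<close> makes the bound
    strict and also puts the constant polynomials outside the first \<open>n\<close> coordinates
    below degree \<open>K\<close>.\<close>
  define K where "K = Suc (\<Sum>i<n. \<Sum>j<n. degree (p i j))"
  have "degree (p i j) < K" if "i < n" "j < n" for i j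
  proof -
    have "degree (p i j) \<le> (\<Sum>j<n. degree (p i j))"
      using that by (intro member_le_sum) auto
    also have "\<dots> \<le> (\<Sum>i<n. \<Sum>j<n. degree (p i j))"
      using that by (intro member_le_sum[of i _ "\<lambda>i. \<Sum>j<n. degree (p i j)"]) auto
    finally show ?thesis by (simp add: K_def)
  qed
  then have "coeff (p i j) k = 0" if "k \<ge> K" "i < n" "j < n" for i j k
    using that by (meson coeff_eq_0 less_le_trans)
  then have P_high: "coeff (P v i) k = 0" if "k \<ge> K" for v i k
    using that by (cases k) (auto simp: P_def coeff_sum K_def)
  have poly_P: "poly (P v i) t = (\<Sum>k<K. t ^ k * coeff (P v i) k)" for v i t
  proof -
    have deg: "degree (P v i) < K"
    proof (rule ccontr)
      assume high: "\<not> degree (P v i) < K"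
      then have "P v i = 0" using P_high[of "degree (P v i)" v i] by simp
      with high show False by (simp add: K_def)
    qed
    have "poly (P v i) t = (\<Sum>k\<le>degree (P v i). t ^ k * coeff (P v i) k)"
      by (simp add: poly_altdef mult.commute)
    also have "\<dots> = (\<Sum>k<K. t ^ k * coeff (P v i) k)"
      using deg by (intro sum.mono_neutral_left) (auto intro: coeff_eq_0)
    finally show ?thesis .
  qed
  have deriv: "poly (pderiv (P v i)) t = mat_op n N (R t v) i" for v i t
  proof -
    \<comment> \<open>The orbit through \<open>R t v\<close> is the orbit through \<open>v\<close>
      with time shifted by \<open>t\<close>, so the derivative at \<open>t\<close> is a derivative
      at \<open>0\<close> of the shifted orbit.\<close>
    have "P v i \<circ>\<^sub>p [:t, 1:] = P (R t v) i"
      using Radd[of _ t v i]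
      by (simp add: poly_eq_poly_eq_iff[symmetric] fun_eq_iff poly_pcompose R_def add.commute)
    moreover have "coeff q 1 = poly (pderiv q) 0" for q :: "'k poly"
      by (simp add: poly_0_coeff_0 coeff_pderiv)
    ultimately have "mat_op n N (R t v) i = poly (pderiv (P v i \<circ>\<^sub>p [:t, 1:])) 0"
      by (simp add: T)
    then show ?thesis by (simp add: pderiv_pcompose poly_pcompose pderiv_pCons)
  qed
  have step: "of_nat (Suc k) * coeff (P v i) (Suc k) = mat_op n N (\<lambda>j. coeff (P v j) k) i" for v i k
  proof -
    have "poly (pderiv (P v i)) t = poly (\<Sum>k<K. monom (mat_op n N (\<lambda>j. coeff (P v j) k) i) k) t" for t
      unfolding deriv R_def poly_P mat_op_sum by (simp add: poly_sum poly_monom mult.commute)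
    then have eq: "pderiv (P v i) = (\<Sum>k<K. monom (mat_op n N (\<lambda>j. coeff (P v j) k) i) k)"
      by (simp only: poly_eq_poly_eq_iff[symmetric] fun_eq_iff) blast
    have "of_nat (Suc k) * coeff (P v i) (Suc k) =
        (if k < K then mat_op n N (\<lambda>j. coeff (P v j) k) i else 0)"
      using arg_cong[OF eq, of "\<lambda>q. coeff q k"] by (simp add: coeff_pderiv coeff_sum)
    also have "\<dots> = mat_op n N (\<lambda>j. coeff (P v j) k) i"
      using P_high[of k v] by (auto simp: mat_op_def)
    finally show ?thesis .
  qed
  have coeffs: "(\<lambda>i. coeff (P v i) k) = (\<lambda>i. 1 / fact k * (mat_op n N ^^ k) v i)" for v k
  proof (induction k)
    case 0
    show ?case using R0[of v] by (simp add: R_def poly_0_coeff_0)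
  next
    case (Suc k)
    show ?case
    proof
      fix i
      have "of_nat (Suc k) * coeff (P v i) (Suc k) = 1 / fact k * (mat_op n N ^^ Suc k) v i"
        unfolding step Suc mat_op_scale by simp
      moreover have "of_nat (Suc k) \<noteq> (0 :: 'k)" by (simp del: of_nat_Suc)
      ultimately show "coeff (P v i) (Suc k) = 1 / fact (Suc k) * (mat_op n N ^^ Suc k) v i"
        by (simp add: field_simps del: of_nat_Suc)
    qed
  qed
  show ?thesis
  proof (rule that[of K N])
    fix v :: "nat \<Rightarrow> 'k"
    show "(mat_op n N ^^ K) v = (\<lambda>_. 0)"
      using coeffs[of v K] P_high[of K v] by (simp add: fun_eq_iff)
  next
    fix t i and v :: "'k vec" assume v: "v \<in> carrier_vec n" and i: "i < n"
    have "(\<rho> t *\<^sub>v v) $ i = R t (($) v) i"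
      using v i carr[of t] by (simp add: R scalar_prod_def atLeast0LessThan)
    also have "\<dots> = exp_op (mat_op n N) K t (($) v) i"
      using coeffs by (simp add: R_def poly_P exp_op_def fun_eq_iff)
    finally show "(\<rho> t *\<^sub>v v) $ i = exp_op (mat_op n N) K t (($) v) i" .
  qed
qed


section \<open>Polynomial curves degenerating to the origin\<close>

text \<open>If \<open>(T ^^ (2 * a)) z = 0\<close>, then \<open>z\<close> generates a module of binary forms of degree less than
  \<open>2 * a\<close>; the curves are the orbits of \<open>(T ^^ a) z\<close> under the elements of \<open>SL\<^sub>2\<close> with rows
  \<open>(1, 0), (t, 1)\<close> and \<open>(1, -1/t), (t, 0)\<close>, which differ by a translation.\<close>

definition contractible :: "((nat \<Rightarrow> 'k) \<Rightarrow> nat \<Rightarrow> 'k :: field_char_0) \<Rightarrow> nat \<Rightarrow> (nat \<Rightarrow> 'k) \<Rightarrow> bool" where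
  "contractible T K v \<longleftrightarrow> (\<exists>X Y. (\<forall>i. poly (X i) 0 = v i) \<and> (\<forall>i. poly (Y i) 0 = 0) \<and>
     (\<forall>t i. t \<noteq> 0 \<longrightarrow> poly (X i) t = exp_op T K (1 / t) (\<lambda>j. poly (Y j) t) i))"

lemma contractible_zero: "contractible (mat_op n N) K (\<lambda>_. 0)"
  unfolding contractible_def
  by (rule exI[of _ "\<lambda>_. 0"], rule exI[of _ "\<lambda>_. 0"]) (simp add: exp_op_def mat_op_pow_zero)

lemma contractible_add:
  assumes "contractible (mat_op n N) K u" "contractible (mat_op n N) K v"
  shows "contractible (mat_op n N) K (\<lambda>i. u i + v i)"
proof -
  obtain X Y where XY: "\<And>i. poly (X i) 0 = u i" "\<And>i. poly (Y i) 0 = 0"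
    "\<And>t i. t \<noteq> 0 \<Longrightarrow> poly (X i) t = exp_op (mat_op n N) K (1 / t) (\<lambda>j. poly (Y j) t) i"
    using assms(1) unfolding contractible_def by blast
  obtain X' Y' where XY': "\<And>i. poly (X' i) 0 = v i" "\<And>i. poly (Y' i) 0 = 0"
    "\<And>t i. t \<noteq> 0 \<Longrightarrow> poly (X' i) t = exp_op (mat_op n N) K (1 / t) (\<lambda>j. poly (Y' j) t) i"
    using assms(2) unfolding contractible_def by blast
  show ?thesis
    unfolding contractible_def
    by (rule exI[of _ "\<lambda>i. X i + X' i"], rule exI[of _ "\<lambda>i. Y i + Y' i"])
      (simp add: XY XY' exp_op_add)
qed

text \<open>With \<open>q = 2 * n + 1 - p\<close> the quotient of factorials is
  \<open>fact q\<close> times a binomial coefficient with bottom index \<open>q\<close>, so the sum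
  is an \<open>n\<close>-th difference. It vanishes for \<open>q < n\<close>, and
  \<open>q = n\<close> is the case \<open>p = n + 1\<close>.\<close>

lemma contraction_coefficient:
  assumes "n < p" "p \<le> 2 * n + 1"
  shows "(\<Sum>m\<le>n. (-1) ^ (n - m) * of_nat (n choose m) * fact (n + 1 + m) / fact n / fact (p + m - n)) =
    (if p = n + 1 then 1 else 0 :: 'k :: field_char_0)"
proof -
  define q where "q = 2 * n + 1 - p"
  have q: "p + m - n = n + 1 + m - q" "q \<le> n + 1 + m" for m
    using assms by (auto simp: q_def)
  have "(\<Sum>m\<le>n. (-1) ^ (n - m) * of_nat (n choose m) * fact (n + 1 + m) / fact n / fact (p + m - n)) =
      (\<Sum>m\<le>n. fact q / fact n * ((-1) ^ (n - m) * of_nat (n choose m) * of_nat ((n + 1 + m) choose q)) :: 'k)"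
    using q by (intro sum.cong refl) (simp add: binomial_fact del: fact_Suc)
  also have "\<dots> = fact q / fact n * (if q < n then 0 else of_nat ((n + 1) choose (q - n)))"
    by (simp only: alternating_binomial_convolution flip: sum_distrib_left)
  also have "\<dots> = (if p = n + 1 then 1 else 0)"
    using assms by (auto simp: q_def)
  finally show ?thesis .
qed

text \<open>Applying \<open>exp (T / t)\<close> to the curve \<open>Y\<close> gives
  \<open>(T ^^ p) z\<close> the coefficient \<open>\<gamma> p * t ^ (d + 1 - p)\<close>, read with
  an integer exponent. All negative powers of \<open>t\<close> cancel because
  \<open>\<gamma>\<close> vanishes for \<open>d + 1 < p\<close> up to \<open>2 * d + 1\<close>, and
  at \<open>t = 0\<close> only \<open>p = d + 1 = a\<close> survives.\<close>

lemma contractible_pow: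
  assumes nil: "\<And>v. (mat_op n N ^^ K) v = (\<lambda>_. 0)"
    and z: "(mat_op n N ^^ (2 * a)) z = (\<lambda>_. 0)"
  shows "contractible (mat_op n N) K ((mat_op n N ^^ a) z)"
proof (cases a)
  case 0
  then show ?thesis using z contractible_zero by simp
next
  case (Suc d)
  define T where "T = mat_op n N"
  \<comment> \<open>Up to the factor \<open>fact d\<close>, these are the coefficients of \<open>t X\<^sup>d\<^sup>+\<^sup>1 (t X - 1)\<^sup>d\<close> in the basis
    \<open>X\<^sup>j / fact j = (T ^^ (2 * d + 1 - j)) z\<close>.\<close>
  define c :: "nat \<Rightarrow> 'a" where
    "c m = (-1) ^ (d - m) * of_nat (d choose m) * fact (d + 1 + m) / fact d" for m
  \<comment> \<open>Here \<open>p + m - d\<close> is the index \<open>k\<close> of the exponential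
    series that carries \<open>(T ^^ (d - m)) z\<close> to \<open>(T ^^ p) z\<close>; the condition
    says that it is not negative.\<close>
  define \<gamma> where "\<gamma> p = (\<Sum>m\<le>d. if d \<le> p + m then c m / fact (p + m - d) else 0)" for p
  have \<gamma>: "\<gamma> p = (if p = d + 1 then 1 else 0)" if "d < p" "p \<le> 2 * d + 1" for p
    using contraction_coefficient[OF that, where 'k = 'a] that by (simp add: \<gamma>_def c_def)
  have Tz: "(T ^^ l) z = (\<lambda>_. 0)" if "2 * d + 2 \<le> l" for l
    using mat_op_pow_zero_mono[OF z, of l] that by (simp add: T_def Suc)
  define X where "X i = (\<Sum>p\<le>d + 1. monom (\<gamma> p * (T ^^ p) z i) (d + 1 - p))" for i
  define Y where "Y i = (\<Sum>m\<le>d. monom (c m * (T ^^ (d - m)) z i) (m + 1))" for i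
  have "poly (X i) 0 = (\<Sum>p\<le>d + 1. if p = d + 1 then (T ^^ a) z i else 0)" for i
    unfolding X_def poly_sum using \<gamma>[of "d + 1"] by (intro sum.cong) (auto simp: poly_monom Suc)
  then have X0: "poly (X i) 0 = (T ^^ a) z i" for i by simp
  have Y0: "poly (Y i) 0 = 0" for i
    by (simp add: Y_def poly_sum poly_monom)
  have XY: "poly (X i) t = exp_op T K (1 / t) (\<lambda>j. poly (Y j) t) i" if "t \<noteq> 0" for t i
  proof -
    \<comment> \<open>A longer truncation leaves the exponential unchanged and reaches every
      \<open>p < 2 * d + 2\<close> after the shift \<open>p = k + (d - m)\<close>; beyond that
      \<open>(T ^^ p) z\<close> is zero.\<close>
    define L where "L = max K (3 * d + 3)"
    define g where "g m p = (if d \<le> p + m then c m / fact (p + m - d) else 0) *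
      ((1 / t) ^ (p + m - d) * t ^ (m + 1)) * (T ^^ p) z i" for m p
    have inner: "(\<Sum>k<L. (1 / t) ^ k / fact k * (c m * t ^ (m + 1) * (T ^^ (k + (d - m))) z i)) =
        (\<Sum>p<2 * d + 2. g m p)" if "m \<le> d" for m
    proof -
      have "(\<Sum>k<L. (1 / t) ^ k / fact k * (c m * t ^ (m + 1) * (T ^^ (k + (d - m))) z i)) =
          (\<Sum>k<L. g m (k + (d - m)))"
        using that by (intro sum.cong refl) (simp add: g_def)
      also have "\<dots> = (\<Sum>p\<in>{d - m..<L + (d - m)}. g m p)"
        by (rule sum.reindex_bij_witness[of _ "\<lambda>p. p - (d - m)" "\<lambda>k. k + (d - m)"]) auto
      also have "\<dots> = (\<Sum>p<L + (d - m). g m p)"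
        by (rule sum.mono_neutral_left) (auto simp: g_def)
      also have "\<dots> = (\<Sum>p<2 * d + 2. g m p)"
        by (rule sum.mono_neutral_right) (auto simp: g_def L_def Tz)
      finally show ?thesis .
    qed
    have Yt: "(\<lambda>j. poly (Y j) t) = (\<lambda>j. \<Sum>m\<le>d. (c m * t ^ (m + 1)) * (T ^^ (d - m)) z j)"
      by (simp add: Y_def poly_sum poly_monom mult_ac)
    have TT: "(T ^^ k) ((T ^^ l) z) = (T ^^ (k + l)) z" for k l by (simp add: funpow_add)
    have "exp_op T K (1 / t) (\<lambda>j. poly (Y j) t) i = exp_op T L (1 / t) (\<lambda>j. poly (Y j) t) i"
      unfolding T_def by (rule fun_cong[OF exp_op_eq]) (auto simp: nil L_def)
    also have "\<dots> = (\<Sum>k<L. \<Sum>m\<le>d. (1 / t) ^ k / fact k * (c m * t ^ (m + 1) * (T ^^ (k + (d - m))) z i))"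
      unfolding exp_op_def Yt by (simp only: mat_op_pow_sum[of _ n N, folded T_def] TT sum_distrib_left)
    also have "\<dots> = (\<Sum>m\<le>d. \<Sum>p<2 * d + 2. g m p)"
      by (subst sum.swap) (use inner in auto)
    also have "\<dots> = (\<Sum>p<2 * d + 2. \<Sum>m\<le>d. g m p)"
      by (rule sum.swap)
    also have "\<dots> = (\<Sum>p<2 * d + 2. poly (if p \<le> d + 1 then monom (\<gamma> p * (T ^^ p) z i) (d + 1 - p) else 0) t)"
    proof (intro sum.cong refl)
      fix p assume p: "p \<in> {..<2 * d + 2}"
      \<comment> \<open>The power of \<open>t\<close> does not depend on \<open>m\<close>; the two
        cases express an integer exponent by natural ones.\<close>
      define h where "h = (if p \<le> d + 1 then t ^ (d + 1 - p) else (1 / t) ^ (p - (d + 1)))"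
      have h: "(1 / t) ^ (p + m - d) * t ^ (m + 1) = h" if "d \<le> p + m" for m
      proof (cases "p \<le> d + 1")
        case True
        then have "m + 1 = (p + m - d) + (d + 1 - p)" using that by simp
        then have "t ^ (m + 1) = t ^ (p + m - d) * t ^ (d + 1 - p)" by (metis power_add)
        then show ?thesis using \<open>t \<noteq> 0\<close> True by (simp add: h_def power_one_over)
      next
        case False
        then have "p + m - d = (m + 1) + (p - (d + 1))" by simp
        then have "(1 / t) ^ (p + m - d) = (1 / t) ^ (m + 1) * (1 / t) ^ (p - (d + 1))"
          by (metis power_add)
        then show ?thesis using \<open>t \<noteq> 0\<close> False by (simp add: h_def power_one_over)
      qed
      have "(\<Sum>m\<le>d. g m p) = \<gamma> p * h * (T ^^ p) z i"
        unfolding \<gamma>_def sum_distrib_right g_def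
      proof (intro sum.cong refl)
        fix m
        show "(if d \<le> p + m then c m / fact (p + m - d) else 0) *
            ((1 / t) ^ (p + m - d) * t ^ (m + 1)) * (T ^^ p) z i =
          (if d \<le> p + m then c m / fact (p + m - d) else 0) * h * (T ^^ p) z i"
          by (cases "d \<le> p + m") (simp_all only: h if_True if_False mult_zero_left)
      qed
      also have "\<dots> = poly (if p \<le> d + 1 then monom (\<gamma> p * (T ^^ p) z i) (d + 1 - p) else 0) t"
        using \<gamma>[of p] p by (auto simp: h_def poly_monom)
      finally show "(\<Sum>m\<le>d. g m p) =
        poly (if p \<le> d + 1 then monom (\<gamma> p * (T ^^ p) z i) (d + 1 - p) else 0) t" .
    qed
    also have "\<dots> = poly (X i) t"
      unfolding X_def poly_sum by (rule sum.mono_neutral_cong_right) auto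
    finally show ?thesis by simp
  qed
  show ?thesis
    unfolding contractible_def T_def[symmetric] using X0 Y0 XY by blast
qed

text \<open>One power of \<open>T\<close> is peeled off at a time: \<open>v\<close> is a
  contractible \<open>u\<close> killed by \<open>T ^^ r\<close> plus \<open>(T ^^ r) z\<close>. The
  range condition at \<open>r\<close> makes \<open>(T ^^ (2 * r)) z\<close> equal to
  \<open>(T ^^ (2 * r + 1)) z'\<close>, so \<open>y = z - T z'\<close> gives a contractible summand
  \<open>(T ^^ r) y\<close> and leaves \<open>(T ^^ Suc r) z'\<close>.\<close>

lemma contractible_of_range:
  assumes nil: "\<And>v. (mat_op n N ^^ K) v = (\<lambda>_. 0)"
    and v: "\<And>r. (mat_op n N ^^ r) v \<in> range (mat_op n N ^^ (2 * r + 1))"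
  shows "contractible (mat_op n N) K v"
proof -
  define T where "T = mat_op n N"
  have Tadd: "(T ^^ m) (\<lambda>i. x i + y i) = (\<lambda>i. (T ^^ m) x i + (T ^^ m) y i)" for m x y
    by (simp add: T_def mat_op_pow_add)
  have Tdiff: "(T ^^ m) (\<lambda>i. x i - y i) = (\<lambda>i. (T ^^ m) x i - (T ^^ m) y i)" for m x y
    using mat_op_pow_add[of m n N x "\<lambda>i. - 1 * y i"] mat_op_pow_scale[of m n N "-1" y]
    by (simp add: T_def)
  have Tcomp: "(T ^^ m) ((T ^^ l) x) = (T ^^ (m + l)) x" for m l x by (simp add: funpow_add)
  have "\<exists>u z. contractible T K u \<and> (\<forall>s\<ge>r. (T ^^ s) u = (\<lambda>_. 0)) \<and> v = (\<lambda>i. u i + (T ^^ r) z i)" for r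
  proof (induction r)
    case 0
    show ?case
      by (rule exI[of _ "\<lambda>_. 0"], rule exI[of _ v])
        (simp add: T_def contractible_zero mat_op_pow_zero)
  next
    case (Suc r)
    then obtain u z where u: "contractible T K u" "\<And>s. s \<ge> r \<Longrightarrow> (T ^^ s) u = (\<lambda>_. 0)"
      and vu: "v = (\<lambda>i. u i + (T ^^ r) z i)" by blast
    obtain z' where z': "(T ^^ r) v = (T ^^ (2 * r + 1)) z'"
      using v[of r] by (auto simp: T_def)
    define y where "y = (\<lambda>i. z i - T z' i)"
    have "(T ^^ r) v = (T ^^ (2 * r)) z"
      unfolding vu Tadd Tcomp using u(2)[of r] by (simp add: mult_2)
    then have y0: "(T ^^ (2 * r)) y = (\<lambda>_. 0)"
      using z' unfolding y_def Tdiff by (simp add: funpow_swap1)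
    show ?case
    proof (intro exI conjI allI impI)
      show "contractible T K (\<lambda>i. u i + (T ^^ r) y i)"
        using contractible_add[of n N K u "(T ^^ r) y"] contractible_pow[OF nil, of r y] u(1) y0
        by (simp add: T_def)
      show "(T ^^ s) (\<lambda>i. u i + (T ^^ r) y i) = (\<lambda>_. 0)" if "Suc r \<le> s" for s
        using u(2)[of s] mat_op_pow_zero_mono[OF y0[unfolded T_def], of "s + r"] that
        unfolding Tadd Tcomp by (simp add: T_def)
      show "v = (\<lambda>i. u i + (T ^^ r) y i + (T ^^ Suc r) z' i)"
        unfolding vu y_def Tdiff by (simp add: funpow_swap1)
    qed
  qed
  \<comment> \<open>At \<open>r = K\<close> the remainder is zero, so \<open>v\<close> is the
    contractible part.\<close>
  from this[of K] nil show ?thesis by (auto simp: T_def)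
qed

section \<open>Invariants along the curves\<close>

lemma carrier_additive_alg_group: "carrier \<G>\<^sub>a = UNIV"
  by (simp add: additive_alg_group_def)

lemma poly_funs_at_curve:
  assumes "f \<in> poly_funs n"
  obtains q where "\<And>t. f (vec n (\<lambda>i. poly (X i) t)) = poly q t"
proof -
  obtain d c where f: "f = (\<lambda>v\<in>carrier_vec n. \<Sum>m\<in>exponents n d. c m * (\<Prod>i<n. v $ i ^ m i))"
    using assms by (auto simp: poly_funs_def poly_funs_le_def)
  show ?thesis
    by (rule that[of "\<Sum>m\<in>exponents n d. [:c m:] * (\<Prod>i<n. X i ^ m i)"])
      (simp add: f poly_sum poly_prod)
qed

text \<open>The case distinction on \<open>i < n\<close> discards the unspecified entries of
  \<open>v\<close> beyond its dimension.\<close>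

lemma invariant_eq_at_contractible:
  fixes \<rho> :: "'k :: field_char_0 \<Rightarrow> 'k mat"
  assumes f: "f \<in> invariants \<G>\<^sub>a n \<rho>"
    and \<rho>: "\<And>t v i. v \<in> carrier_vec n \<Longrightarrow> i < n \<Longrightarrow> (\<rho> t *\<^sub>v v) $ i = exp_op (mat_op n N) K t (($) v) i"
    and carr: "\<And>t. \<rho> t \<in> carrier_mat n n"
    and v: "v \<in> carrier_vec n"
    and contr: "contractible (mat_op n N) K (\<lambda>i. if i < n then v $ i else 0)"
  shows "f v = f (0\<^sub>v n)"
proof -
  obtain X Y where X0: "\<And>i. poly (X i) 0 = (if i < n then v $ i else 0)"
    and Y0: "\<And>i. poly (Y i) 0 = 0"
    and XY: "\<And>t i. t \<noteq> 0 \<Longrightarrow> poly (X i) t = exp_op (mat_op n N) K (1 / t) (\<lambda>j. poly (Y j) t) i"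
    using contr unfolding contractible_def by blast
  define x where "x t = vec n (\<lambda>i. poly (X i) t)" for t
  define y where "y t = vec n (\<lambda>i. poly (Y i) t)" for t
  have pf: "f \<in> poly_funs n" and inv: "act \<G>\<^sub>a n \<rho> g f = f" for g
    using f by (simp_all add: invariants_def carrier_additive_alg_group)
  obtain p where p: "\<And>t. f (x t) = poly p t" using poly_funs_at_curve[OF pf, of X] by (auto simp: x_def)
  obtain q where q: "\<And>t. f (y t) = poly q t" using poly_funs_at_curve[OF pf, of Y] by (auto simp: y_def)
  have "poly p t = poly q t" if "t \<noteq> 0" for t
  proof -
    have "(\<rho> (1 / t) *\<^sub>v y t) $ i = x t $ i" if "i < n" for i
    proof -
      have "(mat_op n N ^^ k) (($) (y t)) i = (mat_op n N ^^ k) (\<lambda>j. poly (Y j) t) i" for k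
        using \<open>i < n\<close> by (intro mat_op_pow_cong) (auto simp: y_def)
      then show ?thesis
        using \<rho>[of "y t" i "1 / t"] XY[OF \<open>t \<noteq> 0\<close>, of i] \<open>i < n\<close>
        by (simp add: exp_op_def x_def y_def)
    qed
    then have "x t = \<rho> (1 / t) *\<^sub>v y t"
      using carr[of "1 / t"] by (intro eq_vecI) (auto simp: x_def)
    \<comment> \<open>The action evaluates at the inverse group element, hence the sign.\<close>
    moreover have "f (y t) = f (\<rho> (1 / t) *\<^sub>v y t)"
      using fun_cong[OF inv[of "- (1 / t)"], of "y t"]
      by (simp add: act_def inv_additive_alg_group y_def)
    ultimately show ?thesis using p q by metis
  qed
  then have "f (x 0) = f (y 0)"
    using poly_eq_at_0_of_eq_elsewhere p q by metis
  moreover have "x 0 = v" using v X0 by (auto simp: x_def)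
  moreover have "y 0 = 0\<^sub>v n" by (auto simp: y_def Y0)
  ultimately show ?thesis by simp
qed

section \<open>Quadratic invariants\<close>

text \<open>By the product rule the derivative of each summand is \<open>g i - g (Suc i)\<close>.
  The sum telescopes to two end terms, both containing \<open>B (2 * r + 1)\<close>.\<close>

lemma pderiv_alternating_sum:
  fixes B :: "nat \<Rightarrow> 'a :: idom poly"
  assumes "\<And>i. pderiv (B i) = B (Suc i)" "B (2 * r + 1) = 0"
  shows "pderiv (\<Sum>i\<le>2 * r. (-1) ^ i * B i * B (2 * r - i)) = 0"
proof -
  define g where "g i = (-1) ^ i * B i * B (2 * r + 1 - i)" for i
  have m1: "pderiv ((-1) ^ i :: 'a poly) = 0" for i
    by (cases "even i") (simp_all add: pderiv_minus)
  have "pderiv (\<Sum>i\<le>2 * r. (-1) ^ i * B i * B (2 * r - i)) = (\<Sum>i\<le>2 * r. g i - g (Suc i))"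
    unfolding sum_comp_morphism[of pderiv, OF pderiv_0 pderiv_add, symmetric] o_def
    by (intro sum.cong refl)
      (simp add: pderiv_mult m1 assms(1) g_def Suc_diff_le algebra_simps)
  also have "\<dots> = g 0 - g (Suc (2 * r))" by (rule sum_telescope)
  also have "\<dots> = 0" using assms(2) by (simp add: g_def)
  finally show ?thesis .
qed

text \<open>Moving \<open>N\<close> to the other side by transposition keeps the functional in
  coordinate form, both for quadratic forms in the entries and for the induction on
  functionals.\<close>

lemma functional_mat_op_pow:
  "\<exists>b. \<forall>v. (\<Sum>j<n. c j * (mat_op n N ^^ i) v j) = (\<Sum>j<n. b j * v j)"
proof (induction i)
  case (Suc i)
  then obtain b where b: "\<And>v. (\<Sum>j<n. c j * (mat_op n N ^^ i) v j) = (\<Sum>j<n. b j * v j)" by blast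
  have "(\<Sum>j<n. c j * (mat_op n N ^^ Suc i) v j) = (\<Sum>l<n. (\<Sum>j<n. b j * N j l) * v l)" for v
  proof -
    have "(\<Sum>j<n. c j * (mat_op n N ^^ Suc i) v j) = (\<Sum>j<n. b j * mat_op n N v j)"
      unfolding funpow_Suc_right o_apply by (rule b)
    also have "\<dots> = (\<Sum>j<n. \<Sum>l<n. b j * N j l * v l)"
      by (simp add: mat_op_def sum_distrib_left mult.assoc)
    also have "\<dots> = (\<Sum>l<n. (\<Sum>j<n. b j * N j l) * v l)"
      by (subst sum.swap) (simp add: sum_distrib_right)
    finally show ?thesis .
  qed
  then show ?case by (intro exI allI)
qed auto

lemma finite_exponents: "finite (exponents n d)"
proof (rule finite_subset)
  show "exponents n d \<subseteq> {m. \<forall>i. (i \<in> {..<n} \<longrightarrow> m i \<in> {..d}) \<and> (i \<notin> {..<n} \<longrightarrow> m i = 0)}"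
  proof (intro subsetI CollectI allI conjI impI)
    fix m i assume m: "m \<in> exponents n d" and i: "i \<in> {..<n}"
    have "m i \<le> (\<Sum>i<n. m i)" using i by (intro member_le_sum) auto
    then show "m i \<in> {..d}" using m by (simp add: exponents_def)
  qed (auto simp: exponents_def)
qed (rule finite_set_of_finite_funs, auto)

lemma quadratic_form_poly_funs_le:
  fixes Q :: "nat \<Rightarrow> nat \<Rightarrow> 'k :: field"
  shows "(\<lambda>v\<in>carrier_vec n. \<Sum>a<n. \<Sum>b<n. Q a b * v $ a * v $ b) \<in> poly_funs_le n 2"
proof -
  \<comment> \<open>The exponent of the monomial \<open>v $ a * v $ b\<close>, a square if
    \<open>a = b\<close>; \<open>c\<close> collects \<open>Q a b\<close> and \<open>Q b a\<close> on
    their common monomial.\<close>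
  define e where "e a b i = (if i = a then 1 else 0) + (if i = b then 1 else 0 :: nat)" for a b i :: nat
  define c where "c m = (\<Sum>a<n. \<Sum>b<n. if m = e a b then Q a b else 0)" for m
  have e: "e a b \<in> exponents n 2" if "a < n" "b < n" for a b
    using that by (auto simp: exponents_def e_def sum.distrib)
  have "(\<Sum>m\<in>exponents n 2. c m * (\<Prod>i<n. v $ i ^ m i)) = (\<Sum>a<n. \<Sum>b<n. Q a b * v $ a * v $ b)"
    for v :: "'k vec"
  proof -
    have "(\<Sum>m\<in>exponents n 2. c m * (\<Prod>i<n. v $ i ^ m i)) =
        (\<Sum>m\<in>exponents n 2. \<Sum>a<n. \<Sum>b<n. if m = e a b then Q a b * (\<Prod>i<n. v $ i ^ m i) else 0)"
      unfolding c_def sum_distrib_right by (intro sum.cong refl) auto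
    also have "\<dots> = (\<Sum>a<n. \<Sum>m\<in>exponents n 2. \<Sum>b<n. if m = e a b then Q a b * (\<Prod>i<n. v $ i ^ m i) else 0)"
      by (rule sum.swap)
    also have "\<dots> = (\<Sum>a<n. \<Sum>b<n. \<Sum>m\<in>exponents n 2. if m = e a b then Q a b * (\<Prod>i<n. v $ i ^ m i) else 0)"
      by (intro sum.cong refl sum.swap)
    also have "\<dots> = (\<Sum>a<n. \<Sum>b<n. Q a b * (\<Prod>i<n. v $ i ^ e a b i))"
      using e by (intro sum.cong refl) (simp add: finite_exponents)
    also have "\<dots> = (\<Sum>a<n. \<Sum>b<n. Q a b * v $ a * v $ b)"
    proof (intro sum.cong refl)
      fix a b assume "a \<in> {..<n}" "b \<in> {..<n}"
      have pow: "v $ i ^ e a b i = (if i = a then v $ i else 1) * (if i = b then v $ i else 1)" for i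
        by (simp add: e_def)
      show "Q a b * (\<Prod>i<n. v $ i ^ e a b i) = Q a b * v $ a * v $ b"
        unfolding pow prod.distrib using \<open>a \<in> {..<n}\<close> \<open>b \<in> {..<n}\<close> by simp
    qed
    finally show ?thesis .
  qed
  then show ?thesis unfolding poly_funs_le_def by (intro CollectI exI[of _ c]) simp
qed

text \<open>Along an exponential orbit the function \<open>b i\<close> becomes a polynomial
  \<open>B i\<close> in time whose derivative is \<open>B (Suc i)\<close>. The alternating sum
  therefore has derivative zero and in characteristic \<open>0\<close> is constant on the
  orbit.\<close>

lemma quadratic_invariant:
  fixes \<rho> :: "'k :: field_char_0 \<Rightarrow> 'k mat"
  assumes \<rho>: "\<And>t v i. v \<in> carrier_vec n \<Longrightarrow> i < n \<Longrightarrow> (\<rho> t *\<^sub>v v) $ i = exp_op (mat_op n N) K t (($) v) i"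
    and carr: "\<And>t. \<rho> t \<in> carrier_mat n n"
    and \<rho>0: "\<rho> 0 = 1\<^sub>m n"
    and nil: "\<And>v. (mat_op n N ^^ K) v = (\<lambda>_. 0)"
    and c: "\<And>u. (\<Sum>j<n. c j * (mat_op n N ^^ (2 * r + 1)) u j) = 0"
  defines "b \<equiv> \<lambda>i v. \<Sum>j<n. c j * (mat_op n N ^^ i) (($) v) j"
  shows "(\<lambda>v\<in>carrier_vec n. \<Sum>i\<le>2 * r. (-1) ^ i * b i v * b (2 * r - i) v)
    \<in> plus_part n (invariants_le \<G>\<^sub>a n \<rho> 2)" (is "?f \<in> _")
proof -
  define T where "T = mat_op n N"
  obtain \<beta> where \<beta>: "\<And>i v. (\<Sum>j<n. c j * (T ^^ i) v j) = (\<Sum>j<n. \<beta> i j * v j)"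
    using functional_mat_op_pow[where n = n and c = c and N = N] unfolding T_def by metis
  have b: "b i v = (\<Sum>j<n. \<beta> i j * v $ j)" for i v
    unfolding b_def T_def[symmetric] \<beta> ..
  define Q where "Q a d = (\<Sum>i\<le>2 * r. (-1) ^ i * \<beta> i a * \<beta> (2 * r - i) d)" for a d
  have "(\<Sum>i\<le>2 * r. (-1) ^ i * b i v * b (2 * r - i) v) = (\<Sum>a<n. \<Sum>d<n. Q a d * v $ a * v $ d)" for v
  proof -
    have "(\<Sum>i\<le>2 * r. (-1) ^ i * b i v * b (2 * r - i) v) =
        (\<Sum>i\<le>2 * r. \<Sum>a<n. \<Sum>d<n. (-1) ^ i * \<beta> i a * \<beta> (2 * r - i) d * v $ a * v $ d)"
      unfolding b sum_distrib_left sum_distrib_right by (subst (2) sum.swap) (simp add: mult_ac)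
    also have "\<dots> = (\<Sum>a<n. \<Sum>i\<le>2 * r. \<Sum>d<n. (-1) ^ i * \<beta> i a * \<beta> (2 * r - i) d * v $ a * v $ d)"
      by (rule sum.swap)
    also have "\<dots> = (\<Sum>a<n. \<Sum>d<n. \<Sum>i\<le>2 * r. (-1) ^ i * \<beta> i a * \<beta> (2 * r - i) d * v $ a * v $ d)"
      by (intro sum.cong refl sum.swap)
    finally show ?thesis by (simp add: Q_def sum_distrib_right)
  qed
  then have f_le: "?f \<in> poly_funs_le n 2"
    using quadratic_form_poly_funs_le[where n = n and Q = Q] by simp
  have inv: "?f (\<rho> t *\<^sub>v v) = ?f v" if v: "v \<in> carrier_vec n" for t v
  proof -
    define B where "B i = (\<Sum>k<K. monom (b (i + k) v / fact k) k)" for i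
    have carr': "\<rho> t *\<^sub>v v \<in> carrier_vec n" for t using carr v by (rule mult_mat_vec_carrier)
    have B: "poly (B i) t = b i (\<rho> t *\<^sub>v v)" for i t
    proof -
      have "b i (\<rho> t *\<^sub>v v) = (\<Sum>j<n. \<beta> i j * exp_op T K t (($) v) j)"
        unfolding b T_def using \<rho>[OF v] by simp
      also have "\<dots> = (\<Sum>j<n. c j * (T ^^ i) (exp_op T K t (($) v)) j)"
        by (simp only: \<beta>)
      also have "\<dots> = (\<Sum>j<n. \<Sum>k<K. c j * (t ^ k / fact k * (T ^^ (i + k)) (($) v) j))"
        unfolding exp_op_def T_def mat_op_pow_sum by (simp add: funpow_add sum_distrib_left)
      also have "\<dots> = (\<Sum>k<K. \<Sum>j<n. c j * (t ^ k / fact k * (T ^^ (i + k)) (($) v) j))"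
        by (rule sum.swap)
      also have "\<dots> = (\<Sum>k<K. b (i + k) v / fact k * t ^ k)"
        unfolding b_def T_def by (simp add: sum_distrib_left sum_divide_distrib sum_distrib_right mult_ac)
      finally show ?thesis by (simp add: B_def poly_sum poly_monom)
    qed
    \<comment> \<open>Large indices vanish by nilpotence or by the condition on \<open>c\<close>.
      The first makes cutting \<open>B\<close> at \<open>K\<close> lossless, the second gives
      \<open>B (2 * r + 1) = 0\<close>.\<close>
    have b_high: "b i v = 0" if "K \<le> i \<or> 2 * r + 1 \<le> i" for i
    proof (cases "K \<le> i")
      case True
      then show ?thesis using mat_op_pow_zero_mono[OF nil] by (simp add: b_def)
    next
      case False
      then have "i = (2 * r + 1) + (i - (2 * r + 1))" using that by simp
      then have "(T ^^ i) (($) v) = (T ^^ (2 * r + 1)) ((T ^^ (i - (2 * r + 1))) (($) v))"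
        by (metis funpow_add o_apply)
      then show ?thesis using c unfolding b_def T_def by metis
    qed
    have coeff_B: "coeff (B i) k = b (i + k) v / fact k" for i k
      using b_high[of "i + k"] by (simp add: B_def coeff_sum)
    have "pderiv (B i) = B (Suc i)" for i
      by (rule poly_eqI) (simp add: coeff_pderiv coeff_B del: of_nat_Suc)
    moreover have "B (2 * r + 1) = 0"
      by (rule poly_eqI) (simp add: coeff_B b_high)
    ultimately have "pderiv (\<Sum>i\<le>2 * r. (-1) ^ i * B i * B (2 * r - i)) = 0"
      by (rule pderiv_alternating_sum)
    then obtain h where h: "(\<Sum>i\<le>2 * r. (-1) ^ i * B i * B (2 * r - i)) = [:h:]"
      using pderiv_iszero by blast
    have "?f (\<rho> t *\<^sub>v v) = poly (\<Sum>i\<le>2 * r. (-1) ^ i * B i * B (2 * r - i)) t" for t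
      using carr' by (simp add: poly_sum B)
    then have "?f (\<rho> t *\<^sub>v v) = ?f (\<rho> 0 *\<^sub>v v)" unfolding h by simp
    then show ?thesis using v by (simp add: \<rho>0)
  qed
  have "act \<G>\<^sub>a n \<rho> g ?f = ?f" for g
  proof
    fix v show "act \<G>\<^sub>a n \<rho> g ?f v = ?f v"
      using inv[of v] by (cases "v \<in> carrier_vec n") (simp_all add: act_def)
  qed
  then have "?f \<in> invariants_le \<G>\<^sub>a n \<rho> 2"
    using f_le unfolding invariants_le_def invariants_def poly_funs_def by blast
  moreover have "?f (0\<^sub>v n) = 0" by (simp add: b)
  ultimately show ?thesis by (simp add: plus_part_def)
qed

text \<open>For \<open>r < m\<close> and \<open>m \<le> 2 * r\<close> put
  \<open>s = 2 * r - m\<close>. The functional composed with \<open>T ^^ (2 * (r - s))\<close> kills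
  the range of \<open>T ^^ (2 * s + 1)\<close>, so the induction hypothesis at \<open>s\<close>
  gives \<open>b m v = 0\<close>. In every product off the middle one index exceeds
  \<open>r\<close>, so the invariant reduces to the square of \<open>b r v\<close> up to
  sign.\<close>

lemma functional_vanishes:
  fixes \<rho> :: "'k :: field_char_0 \<Rightarrow> 'k mat"
  assumes \<rho>: "\<And>t v i. v \<in> carrier_vec n \<Longrightarrow> i < n \<Longrightarrow> (\<rho> t *\<^sub>v v) $ i = exp_op (mat_op n N) K t (($) v) i"
    and carr: "\<And>t. \<rho> t \<in> carrier_mat n n"
    and \<rho>0: "\<rho> 0 = 1\<^sub>m n"
    and nil: "\<And>v. (mat_op n N ^^ K) v = (\<lambda>_. 0)"
    and v: "v \<in> carrier_vec n"
    and vanish: "\<And>f. f \<in> plus_part n (invariants_le \<G>\<^sub>a n \<rho> 2) \<Longrightarrow> f v = 0"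
    and c: "\<And>u. (\<Sum>j<n. c j * (mat_op n N ^^ (2 * r + 1)) u j) = 0"
  shows "(\<Sum>j<n. c j * (mat_op n N ^^ r) (($) v) j) = 0"
  using c
proof (induction r arbitrary: c rule: less_induct)
  case (less r)
  define b where "b i v = (\<Sum>j<n. c j * (mat_op n N ^^ i) (($) v) j)" for i v
  have high: "b m v = 0" if "r < m" "m \<le> 2 * r" for m
  proof -
    define s where "s = 2 * r - m"
    have s: "s < r" "m = 2 * (r - s) + s" "2 * (r - s) + (2 * s + 1) = 2 * r + 1"
      using that by (auto simp: s_def)
    obtain c' where c': "\<And>u. (\<Sum>j<n. c j * (mat_op n N ^^ (2 * (r - s))) u j) = (\<Sum>j<n. c' j * u j)"
      using functional_mat_op_pow[where n = n and c = c and N = N] by metis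
    have c'': "(\<Sum>j<n. c' j * (mat_op n N ^^ k) u j) =
        (\<Sum>j<n. c j * (mat_op n N ^^ (2 * (r - s) + k)) u j)" for u k
      unfolding c'[symmetric] by (simp add: funpow_add)
    have "(\<Sum>j<n. c' j * (mat_op n N ^^ (2 * s + 1)) u j) = 0" for u
      unfolding c'' s(3) by (rule less.prems)
    then have "(\<Sum>j<n. c' j * (mat_op n N ^^ s) (($) v) j) = 0"
      by (rule less.IH[OF s(1)])
    then show ?thesis unfolding c'' b_def s(2)[symmetric] .
  qed
  have "0 = (\<Sum>i\<le>2 * r. (-1) ^ i * b i v * b (2 * r - i) v)"
    using vanish[OF quadratic_invariant[OF \<rho> carr \<rho>0 nil less.prems]] v by (simp add: b_def)
  also have "\<dots> = (\<Sum>i\<le>2 * r. if i = r then (-1) ^ r * (b r v)\<^sup>2 else 0)"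
  proof (intro sum.cong refl)
    fix i assume "i \<in> {..2 * r}"
    then show "(-1) ^ i * b i v * b (2 * r - i) v = (if i = r then (-1) ^ r * (b r v)\<^sup>2 else 0)"
      using high[of i] high[of "2 * r - i"] by (cases i r rule: linorder_cases) (auto simp: power2_eq_square)
  qed
  finally show ?case by (simp add: b_def)
qed

section \<open>The upper bound\<close>

lemma sigma_set_2:
  fixes \<rho> :: "'k :: field_char_0 \<Rightarrow> 'k mat"
  assumes rep: "rational_rep \<G>\<^sub>a n \<rho>"
  shows "sigma_set \<G>\<^sub>a n \<rho> (invariants_le \<G>\<^sub>a n \<rho> 2)"
proof (rule rational_rep_additive_exp[OF rep])
  fix N K
  assume nil: "\<And>v. (mat_op n N ^^ K) v = (\<lambda>_. 0)"
    and \<rho>: "\<And>t v i. v \<in> carrier_vec n \<Longrightarrow> i < n \<Longrightarrow> (\<rho> t *\<^sub>v v) $ i = exp_op (mat_op n N) K t (($) v) i"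
  have carr: "\<rho> t \<in> carrier_mat n n" and \<rho>0: "\<rho> 0 = 1\<^sub>m n" for t
    using rep by (simp_all add: rational_rep_def additive_alg_group_def)
  have "v \<in> nullcone \<G>\<^sub>a n \<rho>" if v: "v \<in> carrier_vec n"
    and vanish: "\<And>f. f \<in> plus_part n (invariants_le \<G>\<^sub>a n \<rho> 2) \<Longrightarrow> f v = 0" for v
  proof -
    define w where "w = (\<lambda>i. if i < n then v $ i else 0)"
    have supp: "(mat_op n N ^^ m) w i = 0" if "n \<le> i" for m i
      using that by (cases m) (auto simp: w_def mat_op_def)
    have supp': "(mat_op n N ^^ (2 * m + 1)) u i = 0" if "n \<le> i" for m u i
      using that by (simp add: mat_op_def)
    have "(mat_op n N ^^ r) w \<in> range (mat_op n N ^^ (2 * r + 1))" for r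
    proof (rule ccontr)
      \<comment> \<open>Duality would give a functional killing the range but not this vector,
        against \<open>functional_vanishes\<close>.\<close>
      assume notin: "(mat_op n N ^^ r) w \<notin> range (mat_op n N ^^ (2 * r + 1))"
      show False
      proof (rule linear_functional_separating[where T = "mat_op n N ^^ (2 * r + 1)" and n = n,
            OF mat_op_pow_add mat_op_pow_scale notin supp supp'])
        fix c
        assume c: "\<And>u. (\<Sum>j<n. c j * (mat_op n N ^^ (2 * r + 1)) u j) = 0"
          "(\<Sum>j<n. c j * (mat_op n N ^^ r) w j) \<noteq> 0"
        have "(\<Sum>j<n. c j * (mat_op n N ^^ r) w j) = (\<Sum>j<n. c j * (mat_op n N ^^ r) (($) v) j)"
          by (intro sum.cong refl arg_cong2[of _ _ _ _ "(*)"] mat_op_pow_cong) (auto simp: w_def)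
        moreover have "(\<Sum>j<n. c j * (mat_op n N ^^ r) (($) v) j) = 0"
          using \<rho> carr \<rho>0 nil v vanish c(1)
          by (rule functional_vanishes[where \<rho> = \<rho> and n = n and N = N and K = K and c = c and r = r])
        ultimately show False using c(2) by simp
      qed
    qed
    then have "contractible (mat_op n N) K w"
      by (rule contractible_of_range[OF nil])
    then have const: "f v = f (0\<^sub>v n)" if "f \<in> invariants \<G>\<^sub>a n \<rho>" for f
      using invariant_eq_at_contractible[OF that \<rho> carr v] by (simp add: w_def)
    have "f v = 0" if "f \<in> plus_part n (invariants \<G>\<^sub>a n \<rho>)" for f
      using that const[of f] by (simp add: plus_part_def)
    then show ?thesis using v by (simp add: nullcone_def)
  qed
  then show "sigma_set \<G>\<^sub>a n \<rho> (invariants_le \<G>\<^sub>a n \<rho> 2)"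
    unfolding sigma_set_def by (auto simp: invariants_le_def)
qed

section \<open>The lower bound from binary quadratic forms\<close>

text \<open>A function of degree at most one is affine; the identity is checked on each monomial,
  which is either constant or a single coordinate.\<close>

lemma poly_funs_le_1_add:
  fixes f :: "'k :: field vec \<Rightarrow> 'k"
  assumes f: "f \<in> poly_funs_le n d" and d: "d \<le> 1"
    and u: "u \<in> carrier_vec n" and w: "w \<in> carrier_vec n"
  shows "f (u + w) + f (0\<^sub>v n) = f u + f w"
proof -
  obtain c where f: "f = (\<lambda>v\<in>carrier_vec n. \<Sum>m\<in>exponents n d. c m * (\<Prod>i<n. v $ i ^ m i))"
    using f by (auto simp: poly_funs_le_def)
  have "(\<Prod>i<n. (u + w) $ i ^ m i) + (\<Prod>i<n. 0\<^sub>v n $ i ^ m i) =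
      (\<Prod>i<n. u $ i ^ m i) + (\<Prod>i<n. w $ i ^ m i)" if m: "m \<in> exponents n d" for m
  proof (cases "(\<Sum>i<n. m i) = 0")
    case True
    then show ?thesis by simp
  next
    case False
    moreover have "(\<Sum>i<n. m i) \<le> 1" using m d by (auto simp: exponents_def)
    ultimately have "(\<Sum>i<n. m i) = 1" by linarith
    then obtain a where a: "a < n" "m a = 1" "\<And>i. i < n \<Longrightarrow> i \<noteq> a \<Longrightarrow> m i = 0"
      by (auto simp: sum_eq_Suc0_iff)
    have mon: "(\<Prod>i<n. x $ i ^ m i) = x $ a" for x :: "'k vec"
    proof -
      have "(\<Prod>i<n. x $ i ^ m i) = (\<Prod>i<n. if i = a then x $ a else 1)"
        using a by (intro prod.cong) auto
      then show ?thesis using a by simp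
    qed
    show ?thesis unfolding mon using u w a by simp
  qed
  then have "c m * (\<Prod>i<n. (u + w) $ i ^ m i) + c m * (\<Prod>i<n. 0\<^sub>v n $ i ^ m i) =
      c m * (\<Prod>i<n. u $ i ^ m i) + c m * (\<Prod>i<n. w $ i ^ m i)" if "m \<in> exponents n d" for m
    using that by (simp flip: distrib_left)
  then show ?thesis using u w by (simp add: f flip: sum.distrib)
qed

text \<open>The vector \<open>(x0, x1, x2)\<close> stands for the form
  \<open>x0 X^2 + 2 x1 X Y + x2 Y^2\<close>, and \<open>t\<close> acts by substituting
  \<open>Y + t X\<close> for \<open>Y\<close>.\<close>

definition quadratic_form_rep :: "'k :: field_char_0 \<Rightarrow> 'k mat" where
  "quadratic_form_rep t = mat 3 3 (\<lambda>(i, j). [[1, 2 * t, t\<^sup>2], [0, 1, t], [0, 0, 1]] ! i ! j)"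

lemma less_3_cases: "(i :: nat) < 3 \<Longrightarrow> i = 0 \<or> i = 1 \<or> i = 2"
  by auto

lemma sum_less_3: "sum f {..<3} = f 0 + f 1 + f (2 :: nat)"
  by (simp add: eval_nat_numeral)

lemma quadratic_form_rep_apply:
  "quadratic_form_rep t *\<^sub>v vec 3 x =
    vec 3 (\<lambda>i. [x 0 + 2 * t * x 1 + t\<^sup>2 * x 2, x 1 + t * x 2, x 2] ! i)"
proof (rule eq_vecI)
  fix i assume "i < dim_vec (vec 3 (\<lambda>i. [x 0 + 2 * t * x 1 + t\<^sup>2 * x 2, x 1 + t * x 2, x 2] ! i))"
  then have "i < 3" by simp
  then show "(quadratic_form_rep t *\<^sub>v vec 3 x) $ i =
      vec 3 (\<lambda>i. [x 0 + 2 * t * x 1 + t\<^sup>2 * x 2, x 1 + t * x 2, x 2] ! i) $ i"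
    by (auto dest!: less_3_cases simp: quadratic_form_rep_def scalar_prod_def
        atLeast0LessThan sum_less_3)
qed (simp add: quadratic_form_rep_def)

lemma rational_rep_quadratic_form_rep: "rational_rep \<G>\<^sub>a 3 (quadratic_form_rep :: 'k :: field_char_0 \<Rightarrow> 'k mat)"
  unfolding rational_rep_def
proof (intro conjI ballI allI impI)
  show "quadratic_form_rep \<one>\<^bsub>\<G>\<^sub>a\<^esub> = (1\<^sub>m 3 :: 'k mat)"
    by (rule eq_matI) (auto dest!: less_3_cases simp: quadratic_form_rep_def additive_alg_group_def)
next
  fix s t :: 'k
  show "quadratic_form_rep (s \<otimes>\<^bsub>\<G>\<^sub>a\<^esub> t) = quadratic_form_rep s * quadratic_form_rep t"
    by (rule eq_matI) (auto dest!: less_3_cases simp: quadratic_form_rep_def additive_alg_group_def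
        scalar_prod_def atLeast0LessThan sum_less_3 power2_eq_square algebra_simps)
next
  fix i j :: nat assume "i < 3" "j < 3"
  then show "\<exists>\<phi>\<in>regular_funs \<G>\<^sub>a. \<forall>t\<in>carrier \<G>\<^sub>a. (quadratic_form_rep t :: 'k mat) $$ (i, j) = \<phi> t"
    by (intro bexI[of _ "poly ([[1, [:0, 2:], [:0, 0, 1:]], [0, 1, [:0, 1:]], [0, 0, 1]] ! i ! j)"])
      (auto dest!: less_3_cases simp: quadratic_form_rep_def additive_alg_group_def power2_eq_square)
qed (simp add: quadratic_form_rep_def)

text \<open>The discriminant shows that \<open>v\<close> lies outside the nullcone. An invariant of
  degree at most one without constant term is additive and takes equal values at two points of an
  orbit that differ by \<open>v\<close>, so it vanishes at \<open>v\<close>.\<close>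

lemma sigma_set_quadratic_form_rep:
  assumes "sigma_set \<G>\<^sub>a 3 quadratic_form_rep
    (invariants_le \<G>\<^sub>a 3 (quadratic_form_rep :: 'k :: field_char_0 \<Rightarrow> 'k mat) d)"
  shows "2 \<le> d"
proof (rule ccontr)
  assume "\<not> 2 \<le> d"
  then have d: "d \<le> 1" by simp
  define v :: "'k vec" where "v = vec 3 (\<lambda>i. [0, 2, 0] ! i)"
  define disc :: "'k vec \<Rightarrow> 'k" where
    "disc = (\<lambda>v\<in>carrier_vec 3. v $ 0 * v $ 2 - (v $ 1)\<^sup>2)"
  have disc_inv: "act \<G>\<^sub>a 3 quadratic_form_rep g disc = disc" for g
  proof
    fix v
    show "act \<G>\<^sub>a 3 quadratic_form_rep g disc v = disc v"
    proof (cases "v \<in> carrier_vec 3")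
      case True
      then obtain x where "v = vec 3 x" by (metis carrier_vecD eq_vecI index_vec dim_vec)
      then show ?thesis
        by (simp add: act_def disc_def inv_additive_alg_group quadratic_form_rep_apply
            power2_eq_square algebra_simps)
    qed (simp add: act_def disc_def)
  qed
  have "disc = (\<lambda>v\<in>carrier_vec 3. \<Sum>a<3. \<Sum>b<3. [[0, 0, 1], [0, -1, 0], [0, 0, 0]] ! a ! b * v $ a * v $ b)"
    by (simp add: disc_def sum_less_3 power2_eq_square fun_eq_iff)
  also have "\<dots> \<in> poly_funs_le 3 2"
    by (rule quadratic_form_poly_funs_le)
  finally have "disc \<in> poly_funs 3"
    unfolding poly_funs_def by (rule UN_I[OF UNIV_I])
  moreover have "disc (0\<^sub>v 3) = 0" by (simp add: disc_def)
  ultimately have "disc \<in> plus_part 3 (invariants \<G>\<^sub>a 3 quadratic_form_rep)"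
    using disc_inv by (simp add: plus_part_def invariants_def)
  moreover have "disc v \<noteq> 0" by (simp add: disc_def v_def)
  moreover have v: "v \<in> carrier_vec 3" by (simp add: v_def)
  ultimately have "v \<in> carrier_vec 3 - nullcone \<G>\<^sub>a 3 quadratic_form_rep"
    unfolding nullcone_def by blast
  then obtain f where f: "f \<in> plus_part 3 (invariants_le \<G>\<^sub>a 3 quadratic_form_rep d)" "f v \<noteq> 0"
    using assms unfolding sigma_set_def by blast
  have fd: "f \<in> poly_funs_le 3 d" and f0: "f (0\<^sub>v 3) = 0"
    and inv: "act \<G>\<^sub>a 3 quadratic_form_rep g f = f" for g
    using f(1) unfolding plus_part_def invariants_le_def invariants_def
    by (simp_all add: carrier_additive_alg_group)
  \<comment> \<open>The points \<open>(1, \<plusminus>1, 1)\<close> of the orbit of \<open>(0, 0, 1)\<close> differ by \<open>v\<close>.\<close>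
  define x :: "'k \<Rightarrow> 'k vec" where "x t = vec 3 (\<lambda>i. [t\<^sup>2, t, 1] ! i)" for t
  have orbit: "f (x t) = f (vec 3 (\<lambda>i. [0, 0, 1] ! i))" for t
    using fun_cong[OF inv[of "- t"], of "vec 3 (\<lambda>i. [0, 0, 1] ! i)"]
    by (simp add: act_def inv_additive_alg_group quadratic_form_rep_apply x_def)
  have "x 1 = x (-1) + v"
    by (rule eq_vecI) (auto dest!: less_3_cases simp: x_def v_def)
  then have "f (x 1) = f (x (-1)) + f v"
    using poly_funs_le_1_add[OF fd d, of "x (-1)" v] v f0 by (simp add: x_def)
  then show False using orbit[of 1] orbit[of "-1"] f(2) by simp
qed

theorem proposition4p6:
  shows "sigma (\<G>\<^sub>a :: ('k, 'k :: {alg_closed_field, field_char_0}) alg_group) = 2"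
proof (rule antisym)
  have "sigma_rep \<G>\<^sub>a n \<rho> \<le> enat 2" if "rational_rep \<G>\<^sub>a n \<rho>" for n and \<rho> :: "'k \<Rightarrow> 'k mat"
    unfolding sigma_rep_def by (rule Inf_lower) (use sigma_set_2[OF that] in blast)
  then show "sigma (\<G>\<^sub>a :: ('k, 'k) alg_group) \<le> 2"
    unfolding sigma_def by (intro Sup_least) (auto simp: numeral_eq_enat)
next
  have "2 \<le> sigma_rep \<G>\<^sub>a 3 (quadratic_form_rep :: 'k \<Rightarrow> 'k mat)"
    unfolding sigma_rep_def
    by (intro Inf_greatest) (auto simp: numeral_eq_enat dest: sigma_set_quadratic_form_rep)
  also have "\<dots> \<le> sigma (\<G>\<^sub>a :: ('k, 'k) alg_group)"
    unfolding sigma_def by (rule Sup_upper) (use rational_rep_quadratic_form_rep in blast)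
  finally show "2 \<le> sigma (\<G>\<^sub>a :: ('k, 'k) alg_group)" .
qed

end
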